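(* There exists a constant $c>0$ such that for every integer $n\ge 1$ and every estimator $\hat f_n=\hat f_n(X_1,\ldots,X_n)$, $$\sup_{f\in\mathcal{F}_s}\ \mathbb{E}_{n,f}\int_{-\infty}^{\infty}\Bigl(\sqrt{\hat f_n(x)}-\sqrt{f(x)}\Bigr)^2\,dx\ \ge\ c\cdot\log n\cdot\frac1n,$$ where, under $\mathbb{E}_{n,f}$, the observations $X_1,\ldots,X_n$ are independent and identically distributed with density $f\in\mathcal{F}_s$.
   Context: Let $\phi(x)=(2\pi)^{-1/2}e^{-x^2/2}$ be the standard normal density on $\mathbb{R}$, and let $\mathcal{P}(\mathbb{R})$ be the set of all Borel probability measures on $\mathbb{R}$. Define the class of probability measures with sub-Gaussian tails $$\mathcal{P}_s(\mathbb{R})=\bigl\{\Pi\in\mathcal{P}(\mathbb{R}):\ \exists\, C>0 \text{ such that } \Pi(\{u:|u|>t\})\le C\exp(-t^2/C)\text{ for all real } t\geq 0\bigr\}$$ (the constant $C$ may depend on $\Pi$), and the class of normal location mixture densities $$\mathcal{F}_s=\Bigl\{f:\ f(x)=(\phi\star\Pi)(x)=\int\phi(x-u)\,d\Pi(u),\ \Pi\in\mathcal{P}_s(\mathbb{R})\Bigr\}.$$ Densities are with respect to Lebesgue measure. $\mathbb{E}_{n,f}$ denotes expectation when $X_1,\ldots,X_n$ are i.i.d. with density $f$. An estimator $\hat f_n$ is a nonnegative function $\hat f_n(x)=\hat f_n(x;X_1,\ldots,X_n)$ that is jointly measurable in $x$ and the observations; it need not belong to $\mathcal{F}_s$. The risk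 may take the value $+\infty$. The constant $c$ does not depend on $n$ or on the estimator. *)

theory Defs
  imports "HOL-Probability.Probability"
begin

definition subgaussian_measures :: "real measure set" where
  "subgaussian_measures =
     {P. real_distribution P \<and>
         (\<exists>C>0. \<forall>t\<ge>0. measure P {u. \<bar>u\<bar> > t} \<le> C * exp (- t\<^sup>2 / C))}"

definition normal_mixture :: "real measure \<Rightarrow> real \<Rightarrow> real" where
  "normal_mixture P x = (\<integral>u. std_normal_density (x - u) \<partial>P)"

definition subgaussian_mixtures :: "(real \<Rightarrow> real) set" where
  "subgaussian_mixtures = normal_mixture ` subgaussian_measures"

text \<open>The observations X_1, ..., X_n are the coordinates X i, for i < n, of a point X of the
  product space. An estimator maps the evaluation point x and the sample X to a value.
  Joint measurability is with respect to the Borel sets; nonnegativity is only required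
  on actual samples, i.e. on the (extensional) points of the product space.\<close>

definition estimator :: "nat \<Rightarrow> (real \<Rightarrow> (nat \<Rightarrow> real) \<Rightarrow> real) \<Rightarrow> bool" where
  "estimator n fhat \<longleftrightarrow>
     (\<lambda>(x, X). fhat x X) \<in> borel_measurable (borel \<Otimes>\<^sub>M (\<Pi>\<^sub>M i\<in>{..<n}. borel)) \<and>
     (\<forall>x. \<forall>X \<in> space (\<Pi>\<^sub>M i\<in>{..<n}. borel). 0 \<le> fhat x X)"

definition iid_law :: "nat \<Rightarrow> (real \<Rightarrow> real) \<Rightarrow> (nat \<Rightarrow> real) measure" where
  "iid_law n f = (\<Pi>\<^sub>M i\<in>{..<n}. density lborel (\<lambda>x. ennreal (f x)))"

definition sq_hellinger :: "(real \<Rightarrow> real) \<Rightarrow> (real \<Rightarrow> real) \<Rightarrow> ennreal" where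
  "sq_hellinger g f = (\<integral>\<^sup>+x. ennreal ((sqrt (g x) - sqrt (f x))\<^sup>2) \<partial>lborel)"

definition hellinger_risk ::
    "nat \<Rightarrow> (real \<Rightarrow> (nat \<Rightarrow> real) \<Rightarrow> real) \<Rightarrow> (real \<Rightarrow> real) \<Rightarrow> ennreal" where
  "hellinger_risk n fhat f = (\<integral>\<^sup>+X. sq_hellinger (\<lambda>x. fhat x X) f \<partial>iid_law n f)"

end

theory Submission
  imports Defs
begin

text \<open>The sub-Gaussian constant may depend on the mixing measure, so the class contains, for every
  \<open>m\<close>, all uniform mixtures of \<open>m\<close> far apart unit normals. With \<open>m = 2 n\<close> every single component
  is missed by the whole sample with probability at least \<open>1 / 2\<close>, and then its location, out of two
  possible values, cannot be guessed. Averaging over all \<open>2 ^ m\<close> choices of the locations, as in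
  Assouad's lemma, every component contributes at least a constant times \<open>1 / m\<close> to the risk. Thus
  the minimax risk is even bounded below by a positive constant.\<close>

section \<open>Product measures\<close>

text \<open>Induction on the index set, exchanging one coordinate's density at a time. The densities
  may have any total mass, so a law can be compared with the product of a sub-probability density
  below it.\<close>

lemma nn_integral_PiM_density_mono:
  fixes f g :: "'a \<Rightarrow> real"
  assumes M: "sigma_finite_measure M" and I: "finite I"
    and f [measurable]: "f \<in> borel_measurable M" and g [measurable]: "g \<in> borel_measurable M"
    and le: "\<And>x. x \<in> space M \<Longrightarrow> f x \<le> g x"
    and F: "F \<in> borel_measurable (PiM I (\<lambda>_. M))"
  shows "(\<integral>\<^sup>+X. F X \<partial>PiM I (\<lambda>_. density M (\<lambda>x. ennreal (f x))))
       \<le> (\<integral>\<^sup>+X. F X \<partial>PiM I (\<lambda>_. density M (\<lambda>x. ennreal (g x))))"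
proof -
  let ?D = "\<lambda>h :: 'a \<Rightarrow> real. density M (\<lambda>x. ennreal (h x))"
  interpret sigma_finite_measure M by fact
  interpret f: product_sigma_finite "\<lambda>_ :: 'b. ?D f"
    by (simp add: product_sigma_finite_def sigma_finite_iff_density_finite)
  interpret g: product_sigma_finite "\<lambda>_ :: 'b. ?D g"
    by (simp add: product_sigma_finite_def sigma_finite_iff_density_finite)
  have sets_f: "sets (PiM J (\<lambda>_. ?D f)) = sets (PiM J (\<lambda>_. M))" for J :: "'b set"
    by (intro sets_PiM_cong) auto
  have sets_g: "sets (PiM J (\<lambda>_. ?D g)) = sets (PiM J (\<lambda>_. M))" for J :: "'b set"
    by (intro sets_PiM_cong) auto
  show ?thesis
    using I F
  proof (induction I arbitrary: F rule: finite_induct)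
    case empty
    show ?case by (simp add: PiM_empty)
  next
    case (insert i I)
    note [measurable] = insert.prems
    have Fg: "F \<in> borel_measurable (PiM (insert i I) (\<lambda>_. ?D g))"
      and Ff: "F \<in> borel_measurable (PiM (insert i I) (\<lambda>_. ?D f))"
      using insert.prems by (simp_all cong: measurable_cong_sets add: sets_f sets_g)
    have meas: "(\<lambda>X. \<integral>\<^sup>+y. ennreal (f y) * F (X(i := y)) \<partial>M)
        \<in> borel_measurable (PiM I (\<lambda>_. M))"
      by measurable
    have upd: "(\<lambda>y. F (X(i := y))) \<in> borel_measurable M" if "X \<in> space (PiM I (\<lambda>_. M))" for X
      using that by measurable
    have "(\<integral>\<^sup>+X. F X \<partial>PiM (insert i I) (\<lambda>_. ?D f))
        = (\<integral>\<^sup>+X. (\<integral>\<^sup>+y. F (X(i := y)) \<partial>?D f) \<partial>PiM I (\<lambda>_. ?D f))"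
      by (rule f.product_nn_integral_insert[OF insert.hyps Ff])
    also have "\<dots> = (\<integral>\<^sup>+X. (\<integral>\<^sup>+y. ennreal (f y) * F (X(i := y)) \<partial>M) \<partial>PiM I (\<lambda>_. ?D f))"
      using upd by (intro nn_integral_cong nn_integral_density) (auto simp: space_PiM)
    \<comment> \<open>The induction hypothesis covers every measurable integrand, so it applies to
      the inner integral, with \<open>f\<close> still in coordinate \<open>i\<close>. The next step
      exchanges that coordinate.\<close>
    also have "\<dots> \<le> (\<integral>\<^sup>+X. (\<integral>\<^sup>+y. ennreal (f y) * F (X(i := y)) \<partial>M) \<partial>PiM I (\<lambda>_. ?D g))"
      by (rule insert.IH[OF meas])
    also have "\<dots> \<le> (\<integral>\<^sup>+X. (\<integral>\<^sup>+y. ennreal (g y) * F (X(i := y)) \<partial>M) \<partial>PiM I (\<lambda>_. ?D g))"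
      by (intro nn_integral_mono mult_right_mono ennreal_leI le) auto
    also have "\<dots> = (\<integral>\<^sup>+X. (\<integral>\<^sup>+y. F (X(i := y)) \<partial>?D g) \<partial>PiM I (\<lambda>_. ?D g))"
      using upd by (intro nn_integral_cong nn_integral_density[symmetric]) (auto simp: space_PiM)
    also have "\<dots> = (\<integral>\<^sup>+X. F X \<partial>PiM (insert i I) (\<lambda>_. ?D g))"
      by (rule g.product_nn_integral_insert[OF insert.hyps Fg, symmetric])
    finally show ?case .
  qed
qed

text \<open>For a density of total mass below 1 this is the mass left in the product, the factor
  that survives in \<open>bin_risk_flip\<close>.\<close>

lemma emeasure_iid_law_space:
  assumes [measurable]: "f \<in> borel_measurable borel"
  shows "emeasure (iid_law n f) (space (iid_law n f)) = (\<integral>\<^sup>+x. ennreal (f x) \<partial>lborel) ^ n"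
proof -
  interpret product_sigma_finite "\<lambda>_ :: nat. density lborel (\<lambda>x. ennreal (f x))"
    by (simp add: product_sigma_finite_def
        sigma_finite_measure.sigma_finite_iff_density_finite[OF sigma_finite_lborel])
  show ?thesis
    unfolding iid_law_def space_PiM by (subst emeasure_PiM) (auto simp: emeasure_density)
qed

section \<open>Finite normal mixtures\<close>

text \<open>The divisor is \<open>m\<close> and not \<open>card A\<close>: a proper subset of the
  components then gives a sub-probability density lying below the full mixture.\<close>

definition location_mixture :: "nat \<Rightarrow> nat set \<Rightarrow> (nat \<Rightarrow> real) \<Rightarrow> real \<Rightarrow> real" where
  "location_mixture m A u x = (\<Sum>k\<in>A. std_normal_density (x - u k)) / real m"

lemma location_mixture_measurable [measurable]: "location_mixture m A u \<in> borel_measurable borel"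
  unfolding location_mixture_def[abs_def] by measurable

lemma location_mixture_nonneg: "0 \<le> location_mixture m A u x"
  by (simp add: location_mixture_def sum_nonneg)

lemma location_mixture_mono:
  "finite B \<Longrightarrow> A \<subseteq> B \<Longrightarrow> location_mixture m A u x \<le> location_mixture m B u x"
  unfolding location_mixture_def by (intro divide_right_mono sum_mono2) auto

lemma nn_integral_location_mixture:
  "(\<integral>\<^sup>+x. ennreal (location_mixture m A u x) \<partial>lborel) = ennreal (card A / m)"
proof -
  have "(\<lambda>x. std_normal_density (x - u k)) = normal_density (u k) 1" for k
    by (simp add: fun_eq_iff normal_density_def)
  then have "integrable lborel (location_mixture m A u)"
       "(\<integral>x. location_mixture m A u x \<partial>lborel) = card A / m"
    by (simp_all add: location_mixture_def[abs_def])
  then show ?thesis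
    by (subst nn_integral_eq_integral) (auto simp: location_mixture_nonneg)
qed

lemma location_mixture_in_subgaussian_mixtures:
  assumes "m > 0"
  shows "location_mixture m {..<m} u \<in> subgaussian_mixtures"
proof -
  \<comment> \<open>The push-forward of the uniform law on indices counts coinciding locations with
    multiplicity, as the sum in \<open>location_mixture\<close> does.\<close>
  define P where "P = distr (measure_pmf (pmf_of_set {..<m})) borel u"
  have P: "real_distribution P"
    unfolding P_def by (intro prob_space.real_distribution_distr[OF measure_pmf.prob_space_axioms]) simp
  then interpret real_distribution P .
  have ne: "{..<m} \<noteq> {}" using assms by auto
  have "location_mixture m {..<m} u = normal_mixture P"
    using ne by (auto simp: fun_eq_iff normal_mixture_def P_def location_mixture_def
        integral_distr integral_pmf_of_set)
  moreover have "P \<in> subgaussian_measures"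
  proof -
    define R where "R = (\<Sum>k<m. \<bar>u k\<bar>)"
    \<comment> \<open>For \<open>t < R\<close> this gives \<open>t\<^sup>2 / C \<le> 1 / 3\<close>,
      so the exponential is at least 2/3 and the bound, with \<open>C \<ge> 3\<close>, at least 2,
      above any probability. From \<open>R\<close> on the tail has measure 0.\<close>
    define C where "C = 3 * R\<^sup>2 + 3"
    have u_le: "\<bar>u k\<bar> \<le> R" if "k < m" for k
      unfolding R_def using that by (intro member_le_sum) auto
    have C: "C \<ge> 3" by (simp add: C_def)
    have "measure P {u. \<bar>u\<bar> > t} \<le> C * exp (- t\<^sup>2 / C)" if t: "t \<ge> 0" for t
    proof (cases "t < R")
      case True
      have "t\<^sup>2 \<le> R\<^sup>2" using t True by (intro power_mono) auto
      then have "t\<^sup>2 / C \<le> 1 / 3" using C by (simp add: pos_divide_le_eq) (simp add: C_def)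
      then have "2 / 3 \<le> exp (- t\<^sup>2 / C)" using exp_ge_add_one_self[of "- t\<^sup>2 / C"] by simp
      then have "3 * (2 / 3) \<le> C * exp (- t\<^sup>2 / C)" using C by (intro mult_mono) auto
      then show ?thesis using prob_le_1[of "{u. \<bar>u\<bar> > t}"] by linarith
    next
      case False
      have "measure P {u. \<bar>u\<bar> > t} = measure (measure_pmf (pmf_of_set {..<m})) {k. \<bar>u k\<bar> > t}"
        unfolding P_def by (subst measure_distr) (auto simp: vimage_def)
      also have "\<dots> = 0"
        using ne u_le False
        by (subst measure_pmf_of_set) (auto simp: disjoint_iff dest: order_trans less_le_trans)
      finally show ?thesis using C by simp
    qed
    then show ?thesis
      unfolding subgaussian_measures_def using P C by (auto intro!: exI[of _ C])
  qed
  ultimately show ?thesis unfolding subgaussian_mixtures_def by blast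
qed

section \<open>Pointwise bounds on the normal density\<close>

lemma std_normal_density_le_exp: "std_normal_density y \<le> exp (- y\<^sup>2 / 2)"
proof -
  have "1 \<le> sqrt (2 * pi)" using pi_gt3 by simp
  then show ?thesis by (simp add: std_normal_density_def field_simps)
qed

lemma std_normal_density_mono: "\<bar>y\<bar> \<le> \<bar>z\<bar> \<Longrightarrow> std_normal_density z \<le> std_normal_density y"
  by (simp add: std_normal_density_def divide_right_mono abs_le_square_iff)

text \<open>The crude bound \<open>exp z \<ge> 1 + z\<close> suffices at a distance linear in
  \<open>m\<close>. The other components of a mixture then add at most 1 in total, before the
  division by \<open>m\<close>.\<close>

lemma std_normal_density_tail:
  assumes "m > 0" "\<bar>y\<bar> \<ge> 2 * real m"
  shows "std_normal_density y \<le> 1 / m"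
proof -
  have "(2 * real m)\<^sup>2 \<le> \<bar>y\<bar>\<^sup>2" using assms by (intro power_mono) auto
  moreover have "real m * 1 \<le> real m * real m" using assms by (intro mult_left_mono) auto
  ultimately have "real m \<le> 1 + y\<^sup>2 / 2" by (simp add: power2_eq_square)
  also have "\<dots> \<le> exp (y\<^sup>2 / 2)" by (rule exp_ge_add_one_self)
  finally have "exp (- y\<^sup>2 / 2) \<le> 1 / m"
    using assms by (simp add: exp_minus field_simps)
  then show ?thesis using std_normal_density_le_exp[of y] by simp
qed

section \<open>The hypercube of mixtures\<close>

text \<open>The spacing leaves room for the unit shift: a point of bin \<open>k\<close> is at
  distance at least 4m - 1, hence at least 2m, from every other location.\<close>

definition location :: "nat \<Rightarrow> nat set \<Rightarrow> nat \<Rightarrow> real" where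
  "location m S k = 4 * real m * real k + of_bool (k \<in> S)"

text \<open>Throughout this interval the unshifted centre is at distance at most 1/4 and the shifted
  one at least 3/4, so the two candidate components differ by at least \<open>gap\<close>.\<close>

definition bin :: "nat \<Rightarrow> nat \<Rightarrow> real set" where
  "bin m k = {4 * real m * real k .. 4 * real m * real k + 1 / 4}"

definition cube_mixture :: "nat \<Rightarrow> nat set \<Rightarrow> real \<Rightarrow> real" where
  "cube_mixture m S = location_mixture m {..<m} (location m S)"

definition flip :: "'a \<Rightarrow> 'a set \<Rightarrow> 'a set" where
  "flip k S = (if k \<in> S then S - {k} else insert k S)"

definition gap :: real where
  "gap = std_normal_density (1 / 4) - std_normal_density (3 / 4)"

lemma gap_pos: "gap > 0"
  by (simp add: gap_def std_normal_density_def divide_strict_right_mono power2_eq_square)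

lemma bin_measurable [measurable]: "bin m k \<in> sets borel"
  by (simp add: bin_def)

lemma emeasure_bin: "emeasure lborel (bin m k) = ennreal (1 / 4)"
  by (simp add: bin_def)

lemma flip_flip [simp]: "flip k (flip k S) = S"
  by (auto simp: flip_def)

lemma mem_flip: "j \<in> flip k S \<longleftrightarrow> (if j = k then k \<notin> S else j \<in> S)"
  by (auto simp: flip_def)

lemma cube_mixture_measurable [measurable]: "cube_mixture m S \<in> borel_measurable borel"
  unfolding cube_mixture_def by measurable

lemma centres_separated:
  assumes "m > 0" "j \<noteq> k"
  shows "4 * real m \<le> \<bar>4 * real m * real k - 4 * real m * real j\<bar>"
proof -
  have "1 \<le> \<bar>int k - int j\<bar>" using assms by auto
  then have "1 \<le> \<bar>real k - real j\<bar>" by linarith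
  then have "4 * real m * 1 \<le> 4 * real m * \<bar>real k - real j\<bar>"
    by (intro mult_left_mono) auto
  also have "\<dots> = \<bar>4 * real m * real k - 4 * real m * real j\<bar>"
    using assms by (simp add: abs_mult flip: right_diff_distrib)
  finally show ?thesis by simp
qed

lemma bins_disjoint:
  assumes "m > 0" "x \<in> bin m j" "x \<in> bin m k"
  shows "j = k"
proof (rule ccontr)
  assume "j \<noteq> k"
  from centres_separated[OF assms(1) this] assms show False
    by (auto simp: bin_def abs_if split: if_splits)
qed

text \<open>The component of the bin contributes at most 1 and each of the others at most 1/m. A
  bound of order 1/m, the size of the gap itself, keeps the gap between the square roots
  large.\<close>

lemma cube_mixture_upper:
  assumes m: "m > 0" and k: "k < m" and x: "x \<in> bin m k"
  shows "cube_mixture m S x \<le> 2 / m"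
proof -
  have "(\<Sum>j<m. std_normal_density (x - location m S j))
      = std_normal_density (x - location m S k)
        + (\<Sum>j\<in>{..<m}-{k}. std_normal_density (x - location m S j))"
    using k by (subst sum.remove[of _ k]) auto
  also have "\<dots> \<le> 1 + (\<Sum>j\<in>{..<m}-{k}. 1 / real m)"
  proof (intro add_mono sum_mono)
    show "std_normal_density (x - location m S k) \<le> 1"
      by (rule order_trans[OF std_normal_density_le_exp]) simp
    fix j assume "j \<in> {..<m} - {k}"
    then have "j \<noteq> k" by auto
    from centres_separated[OF m this] x m show "std_normal_density (x - location m S j) \<le> 1 / m"
      by (intro std_normal_density_tail) (auto simp: bin_def location_def abs_if split: if_splits)
  qed
  also have "\<dots> \<le> 2" using k m by (simp add: divide_simps)
  finally show ?thesis by (simp add: cube_mixture_def location_mixture_def divide_right_mono)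
qed

text \<open>Only component \<open>k\<close> depends on whether \<open>k\<close> is in the set; all
  the others cancel.\<close>

lemma cube_mixture_flip_gap:
  assumes m: "m > 0" and k: "k < m" and x: "x \<in> bin m k"
  shows "\<bar>cube_mixture m S x - cube_mixture m (flip k S) x\<bar> \<ge> gap / m"
proof -
  define y where "y = x - 4 * real m * real k"
  have y: "0 \<le> y" "y \<le> 1 / 4" using x by (auto simp: bin_def y_def)
  have same: "(\<Sum>j\<in>{..<m}-{k}. std_normal_density (x - location m S j))
      = (\<Sum>j\<in>{..<m}-{k}. std_normal_density (x - location m (flip k S) j))"
    by (intro sum.cong) (auto simp: location_def mem_flip)
  have "\<bar>cube_mixture m S x - cube_mixture m (flip k S) x\<bar>
      = \<bar>std_normal_density (x - location m S k)
          - std_normal_density (x - location m (flip k S) k)\<bar> / m"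
    using k same unfolding cube_mixture_def location_mixture_def
    by (simp add: sum.remove[of "{..<m}" k] flip: diff_divide_distrib)
  \<comment> \<open>Which of \<open>S\<close> and \<open>flip k S\<close> contains \<open>k\<close>
    affects only the sign inside the absolute value.\<close>
  also have "\<dots> = \<bar>std_normal_density y - std_normal_density (y - 1)\<bar> / m"
    by (auto simp: location_def mem_flip y_def algebra_simps abs_minus_commute)
  also have "\<dots> \<ge> gap / m"
  proof (rule divide_right_mono)
    have "std_normal_density (1 / 4) \<le> std_normal_density y"
      "std_normal_density (y - 1) \<le> std_normal_density (3 / 4)"
      using y by (auto intro!: std_normal_density_mono)
    then show "gap \<le> \<bar>std_normal_density y - std_normal_density (y - 1)\<bar>"
      unfolding gap_def by linarith
  qed simp
  finally show ?thesis .
qed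

text \<open>Factor a - b as a difference of squares of roots; the sum of the roots is at most twice
  the root of c.\<close>

lemma sq_diff_sqrt_ge:
  fixes a b c d :: real
  assumes "0 \<le> a" "0 \<le> b" "a \<le> c" "b \<le> c" "c > 0" "0 \<le> d" "d \<le> \<bar>a - b\<bar>"
  shows "d\<^sup>2 / (4 * c) \<le> (sqrt a - sqrt b)\<^sup>2"
proof -
  have "d\<^sup>2 \<le> \<bar>a - b\<bar>\<^sup>2" using assms by (intro power_mono) auto
  also have "a - b = (sqrt a - sqrt b) * (sqrt a + sqrt b)"
    using assms by (simp add: algebra_simps)
  then have "\<bar>a - b\<bar>\<^sup>2 = (sqrt a - sqrt b)\<^sup>2 * (sqrt a + sqrt b)\<^sup>2"
    by (simp add: power_mult_distrib)
  also have "\<dots> \<le> (sqrt a - sqrt b)\<^sup>2 * (sqrt c + sqrt c)\<^sup>2"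
    using assms by (intro mult_left_mono power_mono add_mono) auto
  also have "(sqrt c + sqrt c)\<^sup>2 = 4 * c" using assms by (simp add: power2_eq_square)
  finally show ?thesis using assms by (simp add: field_simps)
qed

text \<open>No single value \<open>s\<close> is close to both roots. The gap squared, of order
  1/m^2, is divided by the density bound 2/m, which leaves order 1/m.\<close>

lemma cube_loss_pointwise:
  assumes m: "m > 0" and k: "k < m" and x: "x \<in> bin m k"
  shows "gap\<^sup>2 / (16 * m)
    \<le> (s - sqrt (cube_mixture m S x))\<^sup>2 + (s - sqrt (cube_mixture m (flip k S) x))\<^sup>2"
proof -
  let ?a = "sqrt (cube_mixture m S x)" and ?b = "sqrt (cube_mixture m (flip k S) x)"
  have "(gap / m)\<^sup>2 / (4 * (2 / m)) \<le> (?a - ?b)\<^sup>2"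
    using m cube_mixture_upper[OF assms] cube_mixture_flip_gap[OF assms] gap_pos
    by (intro sq_diff_sqrt_ge) (auto simp: cube_mixture_def location_mixture_nonneg)
  also have "(gap / m)\<^sup>2 / (4 * (2 / m)) = gap\<^sup>2 / (8 * m)"
    using m by (simp add: power2_eq_square field_simps)
  also have "(?a - ?b)\<^sup>2 \<le> 2 * ((s - ?a)\<^sup>2 + (s - ?b)\<^sup>2)"
    using zero_le_power2[of "(s - ?a) + (s - ?b)"] by (simp add: power2_eq_square algebra_simps)
  finally show ?thesis by simp
qed

section \<open>The averaging argument\<close>

definition bin_loss :: "nat \<Rightarrow> (real \<Rightarrow> (nat \<Rightarrow> real) \<Rightarrow> real) \<Rightarrow> nat set \<Rightarrow> nat \<Rightarrow> (nat \<Rightarrow> real) \<Rightarrow> ennreal"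
  where "bin_loss m fhat S k X =
    (\<integral>\<^sup>+x. ennreal ((sqrt (fhat x X) - sqrt (cube_mixture m S x))\<^sup>2) * indicator (bin m k) x \<partial>lborel)"

definition bin_risk :: "nat \<Rightarrow> nat \<Rightarrow> (real \<Rightarrow> (nat \<Rightarrow> real) \<Rightarrow> real) \<Rightarrow> nat set \<Rightarrow> nat \<Rightarrow> ennreal"
  where "bin_risk n m fhat S k = (\<integral>\<^sup>+X. bin_loss m fhat S k X \<partial>iid_law n (cube_mixture m S))"

lemma sets_iid_law [measurable_cong]: "sets (iid_law n f) = sets (\<Pi>\<^sub>M i\<in>{..<n}. borel)"
  unfolding iid_law_def by (intro sets_PiM_cong) auto

lemma space_iid_law: "space (iid_law n f) = space (\<Pi>\<^sub>M i\<in>{..<n}. borel)"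
  by (rule sets_eq_imp_space_eq[OF sets_iid_law])

context
  fixes n m :: nat and fhat :: "real \<Rightarrow> (nat \<Rightarrow> real) \<Rightarrow> real"
  assumes m: "m > 0" and est: "estimator n fhat"
begin

lemma fhat_measurable [measurable]:
  "(\<lambda>(x, X). fhat x X) \<in> borel_measurable (borel \<Otimes>\<^sub>M (\<Pi>\<^sub>M i\<in>{..<n}. borel))"
  using est by (simp add: estimator_def)

lemma fhat_section [measurable]:
  assumes "X \<in> space (\<Pi>\<^sub>M i\<in>{..<n}. borel)"
  shows "(\<lambda>x. fhat x X) \<in> borel_measurable borel"
  using measurable_compose[OF measurable_Pair2'[OF assms] fhat_measurable] by simp

lemma bin_loss_measurable [measurable]:
  "bin_loss m fhat S k \<in> borel_measurable (\<Pi>\<^sub>M i\<in>{..<n}. borel)"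
  unfolding bin_loss_def[abs_def] by measurable

text \<open>The pointwise bound times the bin length 1/4, for each fixed sample.\<close>

lemma bin_loss_flip:
  assumes k: "k < m" and X: "X \<in> space (\<Pi>\<^sub>M i\<in>{..<n}. borel)"
  shows "ennreal (gap\<^sup>2 / (64 * m)) \<le> bin_loss m fhat S k X + bin_loss m fhat (flip k S) k X"
proof -
  note [measurable] = fhat_section[OF X]
  have "ennreal (gap\<^sup>2 / (64 * m)) = ennreal (gap\<^sup>2 / (16 * m)) * emeasure lborel (bin m k)"
    unfolding emeasure_bin by (simp flip: ennreal_mult)
  also have "\<dots> = (\<integral>\<^sup>+x. ennreal (gap\<^sup>2 / (16 * m)) * indicator (bin m k) x \<partial>lborel)"
    by (simp add: nn_integral_cmult_indicator)
  also have "\<dots> \<le> (\<integral>\<^sup>+x. ennreal ((sqrt (fhat x X) - sqrt (cube_mixture m S x))\<^sup>2) * indicator (bin m k) x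
      + ennreal ((sqrt (fhat x X) - sqrt (cube_mixture m (flip k S) x))\<^sup>2) * indicator (bin m k) x \<partial>lborel)"
    using cube_loss_pointwise[OF m k]
    by (intro nn_integral_mono) (auto simp: indicator_def simp flip: ennreal_plus intro!: ennreal_leI)
  also have "\<dots> = bin_loss m fhat S k X + bin_loss m fhat (flip k S) k X"
    unfolding bin_loss_def by (intro nn_integral_add) measurable
  finally show ?thesis .
qed

text \<open>Dropping the \<open>k\<close>-th component leaves a common lower bound for the densities of \<open>S\<close> and
  \<open>flip k S\<close>; its \<open>n\<close>-fold product has mass \<open>(1 - 1 / m) ^ n\<close>.\<close>

lemma bin_risk_flip:
  assumes k: "k < m"
  shows "ennreal (gap\<^sup>2 / (64 * m) * (1 - 1 / m) ^ n)
    \<le> bin_risk n m fhat S k + bin_risk n m fhat (flip k S) k"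
proof -
  define g where "g = location_mixture m ({..<m} - {k}) (location m S)"
  have g_flip: "g = location_mixture m ({..<m} - {k}) (location m (flip k S))"
    by (auto simp: g_def location_mixture_def location_def mem_flip fun_eq_iff
        intro!: arg_cong2[where f = "(/)"] sum.cong)
  have le: "g x \<le> cube_mixture m S x" "g x \<le> cube_mixture m (flip k S) x" for x
    unfolding cube_mixture_def by (simp add: g_def location_mixture_mono)
      (simp add: g_flip location_mixture_mono)
  have [measurable]: "g \<in> borel_measurable borel" by (simp add: g_def)
  have lower: "(\<integral>\<^sup>+X. bin_loss m fhat T k X \<partial>iid_law n g) \<le> bin_risk n m fhat T k"
    if "\<And>x. g x \<le> cube_mixture m T x" for T
  proof -
    have "sets (\<Pi>\<^sub>M i\<in>{..<n}. (lborel :: real measure)) = sets (\<Pi>\<^sub>M i\<in>{..<n}. borel)"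
      by (intro sets_PiM_cong) auto
    then have "bin_loss m fhat T k \<in> borel_measurable (\<Pi>\<^sub>M i\<in>{..<n}. lborel)"
      using bin_loss_measurable measurable_cong_sets by blast
    then show ?thesis
      unfolding bin_risk_def iid_law_def using that
      by (intro nn_integral_PiM_density_mono) (auto intro: lborel.sigma_finite_measure_axioms)
  qed
  have mass: "emeasure (iid_law n g) (space (iid_law n g)) = ennreal ((1 - 1 / m) ^ n)"
    using k m unfolding emeasure_iid_law_space[OF \<open>g \<in> borel_measurable borel\<close>]
    by (simp add: g_def nn_integral_location_mixture ennreal_power of_nat_diff diff_divide_distrib)
  have "ennreal (gap\<^sup>2 / (64 * m) * (1 - 1 / m) ^ n)
      = (\<integral>\<^sup>+X. ennreal (gap\<^sup>2 / (64 * m)) \<partial>iid_law n g)"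
    using m by (subst ennreal_mult) (auto simp: mass)
  also have "\<dots> \<le> (\<integral>\<^sup>+X. bin_loss m fhat S k X + bin_loss m fhat (flip k S) k X \<partial>iid_law n g)"
    by (intro nn_integral_mono bin_loss_flip k) (simp add: space_iid_law)
  also have "\<dots> = (\<integral>\<^sup>+X. bin_loss m fhat S k X \<partial>iid_law n g)
      + (\<integral>\<^sup>+X. bin_loss m fhat (flip k S) k X \<partial>iid_law n g)"
    by (intro nn_integral_add) measurable
  also have "\<dots> \<le> bin_risk n m fhat S k + bin_risk n m fhat (flip k S) k"
    by (intro add_mono lower le)
  finally show ?thesis .
qed

lemma sum_bin_risk_le: "(\<Sum>k<m. bin_risk n m fhat S k) \<le> hellinger_risk n fhat (cube_mixture m S)"
proof -
  have "(\<Sum>k<m. bin_risk n m fhat S k)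
      = (\<integral>\<^sup>+X. (\<Sum>k<m. bin_loss m fhat S k X) \<partial>iid_law n (cube_mixture m S))"
    unfolding bin_risk_def by (intro nn_integral_sum[symmetric]) measurable
  also have "\<dots> \<le> hellinger_risk n fhat (cube_mixture m S)"
    unfolding hellinger_risk_def
  proof (rule nn_integral_mono)
    fix X assume "X \<in> space (iid_law n (cube_mixture m S))"
    then have [measurable]: "(\<lambda>x. fhat x X) \<in> borel_measurable borel"
      by (intro fhat_section) (simp add: space_iid_law)
    have ind: "(\<Sum>k<m. indicator (bin m k) x) \<le> (1 :: ennreal)" for x
    proof (cases "\<exists>k<m. x \<in> bin m k")
      case True
      then obtain k where k: "k < m" "x \<in> bin m k" by blast
      have "(\<Sum>j<m. indicator (bin m j) x) = (\<Sum>j<m. if j = k then 1 else 0 :: ennreal)"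
        using bins_disjoint[OF m] k by (intro sum.cong) (auto simp: indicator_def)
      then show ?thesis using k by simp
    qed (auto simp: indicator_def)
    have "(\<Sum>k<m. bin_loss m fhat S k X) = (\<integral>\<^sup>+x. (\<Sum>k<m.
        ennreal ((sqrt (fhat x X) - sqrt (cube_mixture m S x))\<^sup>2) * indicator (bin m k) x) \<partial>lborel)"
      unfolding bin_loss_def by (intro nn_integral_sum[symmetric]) measurable
    also have "\<dots> \<le> sq_hellinger (\<lambda>x. fhat x X) (cube_mixture m S)"
      unfolding sq_hellinger_def
    proof (rule nn_integral_mono)
      fix x
      show "(\<Sum>k<m. ennreal ((sqrt (fhat x X) - sqrt (cube_mixture m S x))\<^sup>2) * indicator (bin m k) x)
          \<le> ennreal ((sqrt (fhat x X) - sqrt (cube_mixture m S x))\<^sup>2)"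
        using mult_left_mono[OF ind[of x]] by (simp flip: sum_distrib_left)
    qed
    finally show "(\<Sum>k<m. bin_loss m fhat S k X) \<le> sq_hellinger (\<lambda>x. fhat x X) (cube_mixture m S)" .
  qed
  finally show ?thesis .
qed

lemma hypercube_lower_bound:
  "ennreal (gap\<^sup>2 / 128 * (1 - 1 / m) ^ n) \<le> (SUP f\<in>subgaussian_mixtures. hellinger_risk n fhat f)"
    (is "_ \<le> ?s")
proof -
  let ?r = "bin_risk n m fhat" and ?b = "gap\<^sup>2 / (64 * m) * (1 - 1 / m) ^ n"
    and ?q = "gap\<^sup>2 / 128 * (1 - 1 / m) ^ n"
  have b: "?b \<ge> 0" and q: "?q \<ge> 0" using m by simp_all
  have flip_sum: "(\<Sum>S\<in>Pow {..<m}. ?r (flip k S) k) = (\<Sum>S\<in>Pow {..<m}. ?r S k)" if "k < m" for k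
    using that
    by (intro sum.reindex_bij_witness[of _ "flip k" "flip k"])
       (auto simp: mem_flip split: if_splits)
  have "2 ^ m * (real m * ?b) = (\<Sum>k<m. \<Sum>S\<in>Pow {..<m}. ?b)"
    by (simp add: card_Pow)
  then have "ennreal (2 ^ m * (real m * ?b)) = (\<Sum>k<m. \<Sum>S\<in>Pow {..<m}. ennreal ?b)"
    using b by (simp only: sum_ennreal sum_nonneg)
  also have "\<dots> \<le> (\<Sum>k<m. \<Sum>S\<in>Pow {..<m}. ?r S k + ?r (flip k S) k)"
    by (intro sum_mono bin_risk_flip) auto
  also have "\<dots> = (\<Sum>k<m. 2 * (\<Sum>S\<in>Pow {..<m}. ?r S k))"
    by (simp add: sum.distrib flip_sum mult_2)
  also have "\<dots> = 2 * (\<Sum>S\<in>Pow {..<m}. \<Sum>k<m. ?r S k)"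
    by (subst sum.swap) (simp add: sum_distrib_left)
  also have "\<dots> \<le> 2 * (\<Sum>S\<in>Pow {..<m}. ?s)"
  proof (intro mult_left_mono sum_mono)
    fix S
    have "cube_mixture m S \<in> subgaussian_mixtures"
      unfolding cube_mixture_def by (rule location_mixture_in_subgaussian_mixtures[OF m])
    then show "(\<Sum>k<m. ?r S k) \<le> ?s"
      by (intro order_trans[OF sum_bin_risk_le] SUP_upper)
  qed simp
  also have "\<dots> = ennreal (2 ^ m * 2) * ?s"
    by (simp add: card_Pow ennreal_mult mult_ac flip: ennreal_power)
  also have "2 ^ m * (real m * ?b) = (2 ^ m * 2) * ?q"
    using m by simp
  finally have "ennreal ((2 ^ m * 2) * ?q) \<le> ennreal (2 ^ m * 2) * ?s" .
  moreover have "ennreal ((2 ^ m * 2) * ?q) = ennreal (2 ^ m * 2) * ennreal ?q"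
    using q by (intro ennreal_mult) auto
  moreover have "ennreal (2 ^ m * 2) \<noteq> 0" "ennreal (2 ^ m * 2) \<noteq> top"
    by (simp_all add: ennreal_eq_0_iff not_le)
  ultimately show ?thesis
    using ennreal_mult_le_mult_iff by metis
qed

end

theorem theorem1p3:
  shows "\<exists>c::real. c > 0 \<and>
    (\<forall>n::nat. n \<ge> 1 \<longrightarrow>
      (\<forall>fhat :: real \<Rightarrow> (nat \<Rightarrow> real) \<Rightarrow> real. estimator n fhat \<longrightarrow>
        (SUP f \<in> subgaussian_mixtures. hellinger_risk n fhat f)
          \<ge> ennreal (c * ln (real n) * (1 / real n))))"
proof (intro exI[of _ "gap\<^sup>2 / 256"] conjI allI impI)
  show "gap\<^sup>2 / 256 > 0" using gap_pos by simp
  fix n :: nat and fhat :: "real \<Rightarrow> (nat \<Rightarrow> real) \<Rightarrow> real"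
  assume n: "n \<ge> 1" and est: "estimator n fhat"
  have "1 / 2 \<le> (1 - 1 / real (2 * n)) ^ n"
    using Bernoulli_inequality[of "- 1 / real (2 * n)" n] n by (simp add: divide_simps)
  moreover have "ln (real n) * (1 / real n) / 2 \<le> 1 / 2"
    using ln_bound[of "real n"] n by simp
  ultimately have "ln (real n) * (1 / real n) / 2 \<le> (1 - 1 / real (2 * n)) ^ n"
    by (rule order_trans[rotated])
  then have "gap\<^sup>2 / 128 * (ln (real n) * (1 / real n) / 2)
      \<le> gap\<^sup>2 / 128 * (1 - 1 / real (2 * n)) ^ n"
    by (intro mult_left_mono) auto
  then have "ennreal (gap\<^sup>2 / 256 * ln (real n) * (1 / real n))
      \<le> ennreal (gap\<^sup>2 / 128 * (1 - 1 / real (2 * n)) ^ n)"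
    by (intro ennreal_leI) simp
  also have "\<dots> \<le> (SUP f\<in>subgaussian_mixtures. hellinger_risk n fhat f)"
    using n est by (intro hypercube_lower_bound) auto
  finally show "ennreal (gap\<^sup>2 / 256 * ln (real n) * (1 / real n))
      \<le> (SUP f\<in>subgaussian_mixtures. hellinger_risk n fhat f)" .
qed

end
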